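(* Let $f:(E,\mathrm{dep})\to(E',\mathrm{dep}')$ be a morphism of DSCs. If $f$ is furthermore a bimorphism, then $\mathsf{rdp}(f)=f^{-1}:\mathsf{rdp}(E')\to\mathsf{rdp}(E)$ is a morphism of finite lattices (it preserves order, binary joins and binary meets). Furthermore, the construction $\mathsf{rdp}$ extends to a functor $\mathsf{rdp}:\mathsf{DSC}_{\mathrm{bi}}^{op}\to\mathsf{FinLatt}$.
   Context: $P(A)$ denotes the power set of $A$. A preDSC is a pair $(E,\mathrm{dep})$ with $E$ a finite set and $\mathrm{dep}:E\to P(P(E))$ a function; elements of $\mathrm{dep}(e)$ are called depsets of $e$. For $X,Y\subseteq E$ write $X\,\mathrm{rch}\,Y$ if $X\subseteq Y$ and for every $y\in Y$ there is $D\in\mathrm{dep}(y)$ with $D\subseteq X$. A subset $X\subseteq E$ is reachable if there is a finite sequence of subsets with $\varnothing\,\mathrm{rch}\,X_0\,\mathrm{rch}\cdots\mathrm{rch}\,X_n\,\mathrm{rch}\,X$. $\mathsf{rdp}(E)$ is the poset of reachable subsets ordered by inclusion. A subset $X$ is complete if every $e\in X$ has a depset $D\in\mathrm{dep}(e)$ with $D\subseteq X$. A DSC is a preDSC which is irredundant ($D_0\subseteq D_1$ with $D_0,D_1\in\mathrm{dep}(e)$ implies $D_0=D_1$), acyclic ($e\notin D$ for all $D\in\mathrm{dep}(e)$), nonsingular ($\mathrm{dep}(e)\neq\varnothing$ for all $e$) and has complete depsets (all $D\in\mathrm{dep}(e)$ are complete). A function $f:E\to E'$ between DSCs is a morphism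 if $f^{-1}(X)$ is reachable for every reachable $X\subseteq E'$, a comorphism if the image $f(X)$ is reachable for every reachable $X\subseteq E$, and a bimorphism if it is both. $\mathsf{DSC}_{\mathrm{bi}}$ is the category of DSCs and bimorphisms. $\mathsf{FinLatt}$ is the category of finite lattices and order-preserving maps preserving binary joins and binary meets. Joins in $\mathsf{rdp}(E)$ are unions, and the meet of two reachable sets is the union of all reachable sets contained in their intersection. *)

theory Defs
  imports "HOL-Algebra.Lattice"
begin

section \<open>PreDSCs, reachability and DSCs\<close>

record 'a preDSC = "'a partial_object" +
  dep :: "'a \<Rightarrow> 'a set set"

text \<open>
  A function on the finite set \<open>carrier E\<close> is encoded by its extensional representative, so that
  two records satisfying \<open>preDSC\<close> are equal iff they have the same carrier and the same depsets.
\<close>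

definition preDSC :: "'a preDSC \<Rightarrow> bool" where
  "preDSC E \<longleftrightarrow> finite (carrier E) \<and> dep E \<in> carrier E \<rightarrow>\<^sub>E Pow (Pow (carrier E))"

definition rch :: "'a preDSC \<Rightarrow> 'a set \<Rightarrow> 'a set \<Rightarrow> bool" where
  "rch E X Y \<longleftrightarrow> X \<subseteq> carrier E \<and> Y \<subseteq> carrier E \<and> X \<subseteq> Y \<and> (\<forall>y\<in>Y. \<exists>D\<in>dep E y. D \<subseteq> X)"

definition reachable :: "'a preDSC \<Rightarrow> 'a set \<Rightarrow> bool" where
  "reachable E X \<longleftrightarrow>
    (\<exists>(n::nat) Xs. rch E {} (Xs 0) \<and> (\<forall>i<n. rch E (Xs i) (Xs (Suc i))) \<and> rch E (Xs n) X)"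

definition complete_subset :: "'a preDSC \<Rightarrow> 'a set \<Rightarrow> bool" where
  "complete_subset E X \<longleftrightarrow> X \<subseteq> carrier E \<and> (\<forall>e\<in>X. \<exists>D\<in>dep E e. D \<subseteq> X)"

definition irredundant :: "'a preDSC \<Rightarrow> bool" where
  "irredundant E \<longleftrightarrow>
    (\<forall>e\<in>carrier E. \<forall>D0\<in>dep E e. \<forall>D1\<in>dep E e. D0 \<subseteq> D1 \<longrightarrow> D0 = D1)"

definition acyclic_dep :: "'a preDSC \<Rightarrow> bool" where
  "acyclic_dep E \<longleftrightarrow> (\<forall>e\<in>carrier E. \<forall>D\<in>dep E e. e \<notin> D)"

definition nonsingular :: "'a preDSC \<Rightarrow> bool" where
  "nonsingular E \<longleftrightarrow> (\<forall>e\<in>carrier E. dep E e \<noteq> {})"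

definition complete_depsets :: "'a preDSC \<Rightarrow> bool" where
  "complete_depsets E \<longleftrightarrow> (\<forall>e\<in>carrier E. \<forall>D\<in>dep E e. complete_subset E D)"

definition DSC :: "'a preDSC \<Rightarrow> bool" where
  "DSC E \<longleftrightarrow> preDSC E \<and> irredundant E \<and> acyclic_dep E \<and> nonsingular E \<and> complete_depsets E"

definition rdp :: "'a preDSC \<Rightarrow> 'a set gorder" where
  "rdp E = \<lparr>carrier = {X. reachable E X}, eq = (=), le = (\<subseteq>)\<rparr>"


section \<open>Morphisms of DSCs\<close>

definition DSC_morphism :: "'a preDSC \<Rightarrow> 'b preDSC \<Rightarrow> ('a \<Rightarrow> 'b) \<Rightarrow> bool" where
  "DSC_morphism E E' f \<longleftrightarrow> f \<in> carrier E \<rightarrow> carrier E' \<and>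
    (\<forall>X. reachable E' X \<longrightarrow> reachable E (f -` X \<inter> carrier E))"

definition DSC_comorphism :: "'a preDSC \<Rightarrow> 'b preDSC \<Rightarrow> ('a \<Rightarrow> 'b) \<Rightarrow> bool" where
  "DSC_comorphism E E' f \<longleftrightarrow> f \<in> carrier E \<rightarrow> carrier E' \<and>
    (\<forall>X. reachable E X \<longrightarrow> reachable E' (f ` X))"

definition DSC_bimorphism :: "'a preDSC \<Rightarrow> 'b preDSC \<Rightarrow> ('a \<Rightarrow> 'b) \<Rightarrow> bool" where
  "DSC_bimorphism E E' f \<longleftrightarrow> DSC_morphism E E' f \<and> DSC_comorphism E E' f"

definition rdp_map :: "'a preDSC \<Rightarrow> 'b preDSC \<Rightarrow> ('a \<Rightarrow> 'b) \<Rightarrow> 'b set \<Rightarrow> 'a set" where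
  "rdp_map E E' f = (\<lambda>X\<in>carrier (rdp E'). f -` X \<inter> carrier E)"


section \<open>Finite lattices\<close>

text \<open>
  The locale \<open>lattice\<close> allows an empty carrier; here a finite lattice is required to be nonempty
  (hence bounded). A map of finite lattices need not preserve the bounds.
\<close>

definition finite_lattice :: "'a gorder \<Rightarrow> bool" where
  "finite_lattice L \<longleftrightarrow> lattice L \<and> finite (carrier L) \<and> carrier L \<noteq> {}"

definition finlatt_morphism :: "'a gorder \<Rightarrow> 'b gorder \<Rightarrow> ('a \<Rightarrow> 'b) \<Rightarrow> bool" where
  "finlatt_morphism L M h \<longleftrightarrow> finite_lattice L \<and> finite_lattice M \<and>
    h \<in> carrier L \<rightarrow> carrier M \<and> isotone L M h \<and> join_pres L M h \<and> meet_pres L M h"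


section \<open>Categories and functors\<close>

text \<open>
  \<open>Comp C X Y Z g f\<close> is the composite of \<open>f : X \<rightarrow> Y\<close> and \<open>g : Y \<rightarrow> Z\<close>. The objects are arguments
  of \<open>Comp\<close> and of the arrow part of a functor, so hom-sets need not be disjoint.
\<close>

record ('o, 'm) cat =
  Obj :: "'o set"
  Hom :: "'o \<Rightarrow> 'o \<Rightarrow> 'm set"
  Idn :: "'o \<Rightarrow> 'm"
  Comp :: "'o \<Rightarrow> 'o \<Rightarrow> 'o \<Rightarrow> 'm \<Rightarrow> 'm \<Rightarrow> 'm"

locale category =
  fixes C :: "('o, 'm) cat"
  assumes Idn_in_Hom: "X \<in> Obj C \<Longrightarrow> Idn C X \<in> Hom C X X"
    and Comp_in_Hom: "\<lbrakk>X \<in> Obj C; Y \<in> Obj C; Z \<in> Obj C; f \<in> Hom C X Y; g \<in> Hom C Y Z\<rbrakk>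
      \<Longrightarrow> Comp C X Y Z g f \<in> Hom C X Z"
    and Comp_Idn_right: "\<lbrakk>X \<in> Obj C; Y \<in> Obj C; f \<in> Hom C X Y\<rbrakk>
      \<Longrightarrow> Comp C X X Y f (Idn C X) = f"
    and Comp_Idn_left: "\<lbrakk>X \<in> Obj C; Y \<in> Obj C; f \<in> Hom C X Y\<rbrakk>
      \<Longrightarrow> Comp C X Y Y (Idn C Y) f = f"
    and Comp_assoc: "\<lbrakk>W \<in> Obj C; X \<in> Obj C; Y \<in> Obj C; Z \<in> Obj C;
        f \<in> Hom C W X; g \<in> Hom C X Y; h \<in> Hom C Y Z\<rbrakk>
      \<Longrightarrow> Comp C W Y Z h (Comp C W X Y g f) = Comp C W X Z (Comp C X Y Z h g) f"

definition op_cat :: "('o, 'm) cat \<Rightarrow> ('o, 'm) cat" where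
  "op_cat C = \<lparr>Obj = Obj C, Hom = (\<lambda>X Y. Hom C Y X), Idn = Idn C,
    Comp = (\<lambda>X Y Z g f. Comp C Z Y X f g)\<rparr>"

locale cat_functor = source: category C + target: category D
  for C :: "('o, 'm) cat" and D :: "('p, 'n) cat" +
  fixes Fobj :: "'o \<Rightarrow> 'p" and Farr :: "'o \<Rightarrow> 'o \<Rightarrow> 'm \<Rightarrow> 'n"
  assumes Fobj_in_Obj: "X \<in> Obj C \<Longrightarrow> Fobj X \<in> Obj D"
    and Farr_in_Hom: "\<lbrakk>X \<in> Obj C; Y \<in> Obj C; f \<in> Hom C X Y\<rbrakk>
      \<Longrightarrow> Farr X Y f \<in> Hom D (Fobj X) (Fobj Y)"
    and Farr_Idn: "X \<in> Obj C \<Longrightarrow> Farr X X (Idn C X) = Idn D (Fobj X)"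
    and Farr_Comp: "\<lbrakk>X \<in> Obj C; Y \<in> Obj C; Z \<in> Obj C; f \<in> Hom C X Y; g \<in> Hom C Y Z\<rbrakk>
      \<Longrightarrow> Farr X Z (Comp C X Y Z g f)
          = Comp D (Fobj X) (Fobj Y) (Fobj Z) (Farr Y Z g) (Farr X Y f)"

text \<open>
  The objects of the following categories are those whose elements lie in a given type. Arrows
  are extensional functions, so that equality of arrows is equality on the carrier.
\<close>

definition DSC_bi :: "('a preDSC, 'a \<Rightarrow> 'a) cat" where
  "DSC_bi = \<lparr>Obj = {E. DSC E},
    Hom = (\<lambda>E E'. {f \<in> extensional (carrier E). DSC_bimorphism E E' f}),
    Idn = (\<lambda>E. \<lambda>x\<in>carrier E. x),
    Comp = (\<lambda>E E' E'' g f. compose (carrier E) g f)\<rparr>"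

definition FinLatt :: "('a gorder, 'a \<Rightarrow> 'a) cat" where
  "FinLatt = \<lparr>Obj = {L. finite_lattice L},
    Hom = (\<lambda>L M. {h \<in> extensional (carrier L). finlatt_morphism L M h}),
    Idn = (\<lambda>L. \<lambda>x\<in>carrier L. x),
    Comp = (\<lambda>L M N g f. compose (carrier L) g f)\<rparr>"

end

theory Submission
  imports Defs
begin

text \<open>
  The lattice structure on \<open>rdp E\<close> rests on one fact: a union of two reachable sets is reachable.
  Given sequences from \<open>{}\<close> to \<open>X\<close> and from \<open>{}\<close> to \<open>Y\<close>, first run the one leading to \<open>Y\<close>, and then
  run the other with \<open>Y\<close> added to each term; the added elements cause no trouble because a reachable
  set contains a depset of each of its elements (\<open>reachable_imp_complete\<close>, \<open>reachable_Un\<close>). Hence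
  joins are unions and, by finiteness, every set \<open>S\<close> has a largest reachable subset
  (\<open>reachable_core\<close>); applied to \<open>X \<inter> Y\<close> this gives the meet of \<open>X\<close> and \<open>Y\<close>.

  Inverse images commute with unions, so a morphism \<open>f\<close> induces a join-preserving map of lattices.
  For meets the other half of the bimorphism condition enters: direct image of reachable sets is
  left adjoint to inverse image, that is, \<open>f ` Z \<subseteq> S\<close> iff \<open>Z \<subseteq> f -` S\<close>, and a right adjoint
  preserves meets. Concretely, if \<open>Z\<close> is reachable and lies in \<open>f -` X \<inter> f -` Y\<close>, then \<open>f ` Z\<close> is
  a reachable subset of \<open>X \<inter> Y\<close>, hence lies in the meet of \<open>X\<close> and \<open>Y\<close> (\<open>vimage_core\<close>).

  Functoriality is the identity \<open>(g \<circ> f) -` X = f -` (g -` X)\<close>, restricted to carriers.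
\<close>


section \<open>Reachable sets\<close>

lemma reachable_empty: "reachable E {}"
  unfolding reachable_def
  by (rule exI[of _ 0], rule exI[of _ "\<lambda>_. {}"]) (simp add: rch_def)

lemma reachable_step:
  assumes "reachable E X" and "rch E X Y"
  shows "reachable E Y"
proof -
  obtain n Xs where Xs: "rch E {} (Xs 0)" "\<forall>i<n. rch E (Xs i) (Xs (Suc i))" "rch E (Xs n) X"
    using assms(1) by (auto simp: reachable_def)
  have "\<forall>i<Suc n. rch E ((Xs(Suc n := X)) i) ((Xs(Suc n := X)) (Suc i))"
    using Xs by (auto simp: less_Suc_eq)
  then show ?thesis
    unfolding reachable_def using Xs(1) assms(2)
    by (intro exI[of _ "Suc n"] exI[of _ "Xs(Suc n := X)"]) simp
qed

text \<open>
  The reachable sets are thus the least family that contains \<open>{}\<close> and is closed under steps: this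
  rule replaces the explicit sequences in all that follows.
\<close>

lemma reachable_induct [consumes 1, case_names empty step]:
  assumes "reachable E X"
    and "P {}"
    and "\<And>X Y. \<lbrakk>reachable E X; P X; rch E X Y\<rbrakk> \<Longrightarrow> P Y"
  shows "P X"
proof -
  obtain n Xs where Xs: "rch E {} (Xs 0)" "\<forall>i<n. rch E (Xs i) (Xs (Suc i))" "rch E (Xs n) X"
    using assms(1) by (auto simp: reachable_def)
  have "i \<le> n \<Longrightarrow> reachable E (Xs i) \<and> P (Xs i)" for i
  proof (induction i)
    case 0
    then show ?case
      using Xs(1) reachable_empty reachable_step assms(2,3) by blast
  next
    case (Suc i)
    then have "reachable E (Xs i)" "P (Xs i)" "rch E (Xs i) (Xs (Suc i))"
      using Xs(2) by auto
    then show ?case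
      using reachable_step assms(3) by blast
  qed
  then show ?thesis
    using Xs(3) assms(3) by blast
qed

lemma reachable_imp_complete: "reachable E X \<Longrightarrow> complete_subset E X"
proof (induction rule: reachable_induct)
  case empty
  then show ?case by (simp add: complete_subset_def)
next
  case (step X Y)
  then show ?case
    unfolding complete_subset_def rch_def by (meson subset_trans)
qed

lemma reachable_subset_carrier: "reachable E X \<Longrightarrow> X \<subseteq> carrier E"
  using reachable_imp_complete by (auto simp: complete_subset_def)

lemma reachable_Un:
  assumes "reachable E X" and Y: "reachable E Y"
  shows "reachable E (X \<union> Y)"
  using assms(1)
proof (induction rule: reachable_induct)
  case empty
  then show ?case using Y by simp
next
  case (step X X')
  \<comment> \<open>A step remains a step after adding a complete set to both of its ends.\<close>
  have "rch E (X \<union> Y) (X' \<union> Y)"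
    unfolding rch_def
  proof (intro conjI ballI)
    fix y
    assume "y \<in> X' \<union> Y"
    then obtain D where "D \<in> dep E y" "D \<subseteq> X \<or> D \<subseteq> Y"
      using step.hyps(2) reachable_imp_complete[OF Y]
      unfolding rch_def complete_subset_def by (elim UnE) meson+
    then show "\<exists>D\<in>dep E y. D \<subseteq> X \<union> Y"
      by (intro bexI[of _ D]) auto
  qed (use step.hyps(2) reachable_subset_carrier[OF Y] in \<open>auto simp: rch_def\<close>)
  then show ?case
    using step.IH reachable_step by blast
qed

lemma reachable_Union:
  assumes "finite A" and "\<And>X. X \<in> A \<Longrightarrow> reachable E X"
  shows "reachable E (\<Union>A)"
  using assms by (induction A rule: finite_induct) (auto simp: reachable_empty reachable_Un)

lemma finite_reachable:
  assumes "preDSC E"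
  shows "finite {X. reachable E X}"
proof (rule finite_subset)
  show "{X. reachable E X} \<subseteq> Pow (carrier E)"
    using reachable_subset_carrier by blast
  show "finite (Pow (carrier E))"
    using assms by (simp add: preDSC_def)
qed

definition reachable_core :: "'a preDSC \<Rightarrow> 'a set \<Rightarrow> 'a set" where
  "reachable_core E S = \<Union>{Z. reachable E Z \<and> Z \<subseteq> S}"

lemma reachable_core_subset: "reachable_core E S \<subseteq> S"
  by (auto simp: reachable_core_def)

lemma reachable_core_upper: "\<lbrakk>reachable E Z; Z \<subseteq> S\<rbrakk> \<Longrightarrow> Z \<subseteq> reachable_core E S"
  by (auto simp: reachable_core_def)

lemma reachable_reachable_core:
  assumes "preDSC E"
  shows "reachable E (reachable_core E S)"
  unfolding reachable_core_def
  by (rule reachable_Union) (auto intro: finite_subset[OF _ finite_reachable[OF assms]])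


section \<open>The lattice of reachable sets\<close>

lemma carrier_rdp [simp]: "carrier (rdp E) = {X. reachable E X}"
  and le_rdp [simp]: "X \<sqsubseteq>\<^bsub>rdp E\<^esub> Y \<longleftrightarrow> X \<subseteq> Y"
  and eq_rdp [simp]: "eq (rdp E) = (=)"
  by (simp_all add: rdp_def)

lemma partial_order_rdp: "partial_order (rdp E)"
  by unfold_locales auto

lemma least_Upper_rdp:
  assumes "reachable E X" and "reachable E Y"
  shows "least (rdp E) (X \<union> Y) (Upper (rdp E) {X, Y})"
proof (rule least_UpperI)
  fix Z
  assume "Z \<in> Upper (rdp E) {X, Y}"
  then show "X \<union> Y \<sqsubseteq>\<^bsub>rdp E\<^esub> Z"
    using assms by (simp add: Upper_def)
qed (use assms reachable_Un in auto)

lemma greatest_Lower_rdp: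
  assumes "preDSC E" and "reachable E X" and "reachable E Y"
  shows "greatest (rdp E) (reachable_core E (X \<inter> Y)) (Lower (rdp E) {X, Y})"
proof (rule greatest_LowerI)
  fix Z
  assume "Z \<in> Lower (rdp E) {X, Y}"
  then have "reachable E Z" "Z \<subseteq> X \<inter> Y"
    using assms(2,3) by (simp_all add: Lower_def)
  then show "Z \<sqsubseteq>\<^bsub>rdp E\<^esub> reachable_core E (X \<inter> Y)"
    by (simp add: reachable_core_upper)
qed (use assms reachable_reachable_core reachable_core_subset[of E "X \<inter> Y"] in auto)

lemma lattice_rdp:
  assumes "preDSC E"
  shows "lattice (rdp E)"
proof -
  interpret partial_order "rdp E"
    by (rule partial_order_rdp)
  show ?thesis
  proof unfold_locales
    fix X Y
    assume "X \<in> carrier (rdp E)" "Y \<in> carrier (rdp E)"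
    then have XY: "reachable E X" "reachable E Y"
      by simp_all
    show "\<exists>S. least (rdp E) S (Upper (rdp E) {X, Y})"
      using least_Upper_rdp[OF XY] by (rule exI)
    show "\<exists>S. greatest (rdp E) S (Lower (rdp E) {X, Y})"
      using greatest_Lower_rdp[OF assms XY] by (rule exI)
  qed
qed

lemma finite_lattice_rdp: "preDSC E \<Longrightarrow> finite_lattice (rdp E)"
  using lattice_rdp finite_reachable reachable_empty by (auto simp: finite_lattice_def)

lemma join_rdp:
  assumes "reachable E X" and "reachable E Y"
  shows "X \<squnion>\<^bsub>rdp E\<^esub> Y = X \<union> Y"
proof -
  interpret partial_order "rdp E"
    by (rule partial_order_rdp)
  show ?thesis
    unfolding join_def sup_def
    by (rule some_equality) (use least_Upper_rdp[OF assms] least_unique in blast)+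
qed

lemma meet_rdp:
  assumes "preDSC E" and "reachable E X" and "reachable E Y"
  shows "X \<sqinter>\<^bsub>rdp E\<^esub> Y = reachable_core E (X \<inter> Y)"
proof -
  interpret partial_order "rdp E"
    by (rule partial_order_rdp)
  show ?thesis
    unfolding meet_def inf_def
    by (rule some_equality) (use greatest_Lower_rdp[OF assms] greatest_unique in blast)+
qed


section \<open>The map induced by a bimorphism\<close>

lemma morphism_vimage:
  "\<lbrakk>DSC_morphism E E' f; reachable E' X\<rbrakk> \<Longrightarrow> reachable E (f -` X \<inter> carrier E)"
  by (simp add: DSC_morphism_def)

lemma comorphism_image: "\<lbrakk>DSC_comorphism E E' f; reachable E X\<rbrakk> \<Longrightarrow> reachable E' (f ` X)"
  by (simp add: DSC_comorphism_def)

text \<open>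
  The first inclusion uses that inverse images of reachable sets are reachable, the second that
  direct images are. For a morphism that is not a comorphism, a reachable \<open>Z\<close> inside \<open>f -` S\<close> may
  have an image that no reachable subset of \<open>S\<close> contains.
\<close>

lemma vimage_core:
  assumes "preDSC E'" and "DSC_bimorphism E E' f"
  shows "f -` reachable_core E' S \<inter> carrier E = reachable_core E (f -` S \<inter> carrier E)"
proof
  have f: "DSC_morphism E E' f" "DSC_comorphism E E' f"
    using assms(2) by (auto simp: DSC_bimorphism_def)
  show "f -` reachable_core E' S \<inter> carrier E \<subseteq> reachable_core E (f -` S \<inter> carrier E)"
    using morphism_vimage[OF f(1) reachable_reachable_core[OF assms(1), of S]]
      reachable_core_subset[of E' S]
    by (intro reachable_core_upper) auto
  show "reachable_core E (f -` S \<inter> carrier E) \<subseteq> f -` reachable_core E' S \<inter> carrier E"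
  proof
    fix x
    assume "x \<in> reachable_core E (f -` S \<inter> carrier E)"
    then obtain Z where Z: "reachable E Z" "Z \<subseteq> f -` S \<inter> carrier E" "x \<in> Z"
      by (auto simp: reachable_core_def)
    have "f ` Z \<subseteq> reachable_core E' S"
      using Z comorphism_image[OF f(2)] by (intro reachable_core_upper) auto
    then show "x \<in> f -` reachable_core E' S \<inter> carrier E"
      using Z by auto
  qed
qed

lemma rdp_map_apply: "reachable E' X \<Longrightarrow> rdp_map E E' f X = f -` X \<inter> carrier E"
  by (simp add: rdp_map_def)

lemma rdp_map_closed:
  "DSC_morphism E E' f \<Longrightarrow> rdp_map E E' f \<in> carrier (rdp E') \<rightarrow> carrier (rdp E)"
  by (simp add: rdp_map_apply morphism_vimage)

lemma rdp_map_join_pres: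
  assumes "preDSC E" and "preDSC E'" and "DSC_morphism E E' f"
  shows "join_pres (rdp E') (rdp E) (rdp_map E E' f)"
  using assms
  by (auto simp: join_pres_def lattice_rdp join_rdp reachable_Un rdp_map_apply morphism_vimage)

lemma rdp_map_meet_pres:
  assumes "preDSC E" and "preDSC E'" and f: "DSC_bimorphism E E' f"
  shows "meet_pres (rdp E') (rdp E) (rdp_map E E' f)"
  unfolding meet_pres_def
proof (intro conjI ballI)
  show "lattice (rdp E')" "lattice (rdp E)"
    using assms(1,2) by (simp_all add: lattice_rdp)
next
  fix X Y
  assume "X \<in> carrier (rdp E')" "Y \<in> carrier (rdp E')"
  then have XY: "reachable E' X" "reachable E' Y"
    by auto
  have m: "DSC_morphism E E' f"
    using f by (simp add: DSC_bimorphism_def)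
  have "rdp_map E E' f (X \<sqinter>\<^bsub>rdp E'\<^esub> Y) = f -` reachable_core E' (X \<inter> Y) \<inter> carrier E"
    using assms XY by (simp add: meet_rdp rdp_map_apply reachable_reachable_core)
  also have "\<dots> = reachable_core E (f -` (X \<inter> Y) \<inter> carrier E)"
    by (rule vimage_core[OF assms(2) f])
  also have "f -` (X \<inter> Y) \<inter> carrier E = (f -` X \<inter> carrier E) \<inter> (f -` Y \<inter> carrier E)"
    by auto
  also have "reachable_core E \<dots> = rdp_map E E' f X \<sqinter>\<^bsub>rdp E\<^esub> rdp_map E E' f Y"
    using assms(1) XY m by (simp add: meet_rdp rdp_map_apply morphism_vimage)
  finally show "rdp_map E E' f (X \<sqinter>\<^bsub>rdp E'\<^esub> Y)
      = rdp_map E E' f X \<sqinter>\<^bsub>rdp E\<^esub> rdp_map E E' f Y" .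
qed

lemma rdp_map_finlatt_morphism:
  assumes "preDSC E" and "preDSC E'" and "DSC_bimorphism E E' f"
  shows "finlatt_morphism (rdp E') (rdp E) (rdp_map E E' f)"
proof -
  have m: "DSC_morphism E E' f"
    using assms(3) by (simp add: DSC_bimorphism_def)
  have j: "join_pres (rdp E') (rdp E) (rdp_map E E' f)"
    using assms(1,2) m by (rule rdp_map_join_pres)
  show ?thesis
    unfolding finlatt_morphism_def
    by (intro conjI finite_lattice_rdp assms(1,2) rdp_map_closed[OF m] j
        join_pres_isotone[OF rdp_map_closed[OF m] j] rdp_map_meet_pres[OF assms])
qed


section \<open>The categories and the functor\<close>

lemma bimorphism_restrict_id: "DSC_bimorphism E E (\<lambda>x\<in>carrier E. x)"
proof -
  have "(\<lambda>x\<in>carrier E. x) -` X \<inter> carrier E = X" "(\<lambda>x\<in>carrier E. x) ` X = X"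
    if "reachable E X" for X
    using reachable_subset_carrier[OF that] by auto
  then show ?thesis
    by (auto simp: DSC_bimorphism_def DSC_morphism_def DSC_comorphism_def)
qed

lemma vimage_compose_carrier:
  assumes "f \<in> carrier E \<rightarrow> carrier E'"
  shows "compose (carrier E) g f -` X \<inter> carrier E
      = f -` (g -` X \<inter> carrier E') \<inter> carrier E"
  using assms by (auto simp: compose_def)

lemma bimorphism_compose:
  assumes "DSC_bimorphism E E' f" and "DSC_bimorphism E' E'' g"
  shows "DSC_bimorphism E E'' (compose (carrier E) g f)"
proof -
  have f: "f \<in> carrier E \<rightarrow> carrier E'" and g: "g \<in> carrier E' \<rightarrow> carrier E''"
    and m: "DSC_morphism E E' f" "DSC_morphism E' E'' g"
    and c: "DSC_comorphism E E' f" "DSC_comorphism E' E'' g"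
    using assms by (auto simp: DSC_bimorphism_def DSC_morphism_def)
  have closed: "compose (carrier E) g f \<in> carrier E \<rightarrow> carrier E''"
    using f g by (auto simp: compose_def)
  have vimage: "reachable E (compose (carrier E) g f -` X \<inter> carrier E)" if "reachable E'' X" for X
    unfolding vimage_compose_carrier[OF f]
    by (intro morphism_vimage[OF m(1)] morphism_vimage[OF m(2)] that)
  have image: "reachable E'' (compose (carrier E) g f ` X)" if X: "reachable E X" for X
  proof -
    have "compose (carrier E) g f ` X = g ` (f ` X)"
      unfolding image_image
      by (rule image_cong) (use reachable_subset_carrier[OF X] in \<open>auto simp: compose_def\<close>)
    then show ?thesis
      using comorphism_image[OF c(2) comorphism_image[OF c(1) X]] by simp
  qed
  show ?thesis
    unfolding DSC_bimorphism_def DSC_morphism_def DSC_comorphism_def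
    using closed vimage image by blast
qed

lemma category_DSC_bi: "category DSC_bi"
proof
  fix W X Y Z :: "'a preDSC" and f g h :: "'a \<Rightarrow> 'a"
  assume "f \<in> Hom DSC_bi W X"
  then show "Comp DSC_bi W Y Z h (Comp DSC_bi W X Y g f)
      = Comp DSC_bi W X Z (Comp DSC_bi X Y Z h g) f"
    by (auto simp: DSC_bi_def DSC_bimorphism_def DSC_morphism_def intro: compose_assoc)
next
  fix X Y :: "'a preDSC" and f :: "'a \<Rightarrow> 'a"
  assume "f \<in> Hom DSC_bi X Y"
  then show "Comp DSC_bi X Y Y (Idn DSC_bi Y) f = f"
    and "Comp DSC_bi X X Y f (Idn DSC_bi X) = f"
    by (auto simp: DSC_bi_def DSC_bimorphism_def DSC_morphism_def Id_compose compose_Id)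
qed (auto simp: DSC_bi_def bimorphism_restrict_id bimorphism_compose compose_extensional)

lemma finlatt_morphism_restrict_id:
  assumes "finite_lattice L"
  shows "finlatt_morphism L L (\<lambda>x\<in>carrier L. x)"
proof -
  interpret lattice L
    using assms by (simp add: finite_lattice_def)
  show ?thesis
    using assms weak_partial_order_axioms lattice_axioms
    by (auto simp: finlatt_morphism_def isotone_def join_pres_def meet_pres_def)
qed

lemma finlatt_morphism_compose:
  assumes "finlatt_morphism L M f" and "finlatt_morphism M N g"
  shows "finlatt_morphism L N (compose (carrier L) g f)"
proof -
  interpret lattice L
    using assms by (simp add: finlatt_morphism_def finite_lattice_def)
  have f: "f \<in> carrier L \<rightarrow> carrier M"
    using assms by (simp add: finlatt_morphism_def)
  then show ?thesis
    using assms
    by (auto simp: finlatt_morphism_def isotone_def join_pres_def meet_pres_def compose_def Pi_iff)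
qed

lemma category_FinLatt: "category FinLatt"
proof
  fix W X Y Z :: "'a gorder" and f g h :: "'a \<Rightarrow> 'a"
  assume "f \<in> Hom FinLatt W X"
  then show "Comp FinLatt W Y Z h (Comp FinLatt W X Y g f)
      = Comp FinLatt W X Z (Comp FinLatt X Y Z h g) f"
    by (auto simp: FinLatt_def finlatt_morphism_def intro: compose_assoc)
next
  fix X Y :: "'a gorder" and f :: "'a \<Rightarrow> 'a"
  assume "f \<in> Hom FinLatt X Y"
  then show "Comp FinLatt X Y Y (Idn FinLatt Y) f = f"
    and "Comp FinLatt X X Y f (Idn FinLatt X) = f"
    by (auto simp: FinLatt_def finlatt_morphism_def Id_compose compose_Id)
qed (auto simp: FinLatt_def finlatt_morphism_restrict_id finlatt_morphism_compose)

lemma category_op: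
  assumes "category C"
  shows "category (op_cat C)"
proof -
  interpret category C by fact
  show ?thesis
    by unfold_locales
      (auto simp: op_cat_def Idn_in_Hom Comp_in_Hom Comp_Idn_right Comp_Idn_left Comp_assoc)
qed

lemma rdp_map_restrict_id: "rdp_map E E (\<lambda>x\<in>carrier E. x) = (\<lambda>X\<in>carrier (rdp E). X)"
  unfolding rdp_map_def
  by (rule restrict_ext) (use reachable_subset_carrier in fastforce)

lemma rdp_map_compose:
  assumes "f \<in> carrier E \<rightarrow> carrier E'" and g: "DSC_morphism E' E'' g"
  shows "rdp_map E E'' (compose (carrier E) g f)
      = compose (carrier (rdp E'')) (rdp_map E E' f) (rdp_map E' E'' g)"
  by (rule ext)
    (simp add: rdp_map_def compose_def[of "{X. reachable E'' X}"] vimage_compose_carrier[OF assms(1)]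
      morphism_vimage[OF g])

lemma rdp_functor:
  "cat_functor (op_cat (DSC_bi :: ('c preDSC, 'c \<Rightarrow> 'c) cat)) FinLatt
    rdp (\<lambda>E' E f. rdp_map E E' f)"
proof (intro cat_functor.intro cat_functor_axioms.intro)
  show "category (op_cat (DSC_bi :: ('c preDSC, 'c \<Rightarrow> 'c) cat))"
    by (intro category_op category_DSC_bi)
  show "category (FinLatt :: ('c set gorder, _) cat)"
    by (rule category_FinLatt)
next
  fix X :: "'c preDSC"
  assume "X \<in> Obj (op_cat DSC_bi)"
  then show "rdp X \<in> Obj FinLatt"
    by (simp add: op_cat_def DSC_bi_def FinLatt_def DSC_def finite_lattice_rdp)
next
  fix X Y :: "'c preDSC" and f
  assume "X \<in> Obj (op_cat DSC_bi)" "Y \<in> Obj (op_cat DSC_bi)" "f \<in> Hom (op_cat DSC_bi) X Y"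
  then show "rdp_map Y X f \<in> Hom FinLatt (rdp X) (rdp Y)"
    by (simp add: op_cat_def DSC_bi_def FinLatt_def DSC_def rdp_map_finlatt_morphism)
      (simp add: rdp_map_def)
next
  fix X :: "'c preDSC"
  show "rdp_map X X (Idn (op_cat DSC_bi) X) = Idn FinLatt (rdp X)"
    using rdp_map_restrict_id[of X] by (simp add: op_cat_def DSC_bi_def FinLatt_def)
next
  fix X Y Z :: "'c preDSC" and f g
  assume "f \<in> Hom (op_cat DSC_bi) X Y" "g \<in> Hom (op_cat DSC_bi) Y Z"
  then have "g \<in> carrier Z \<rightarrow> carrier Y" "DSC_morphism Y X f"
    by (auto simp: op_cat_def DSC_bi_def DSC_bimorphism_def DSC_morphism_def)
  then show "rdp_map Z X (Comp (op_cat DSC_bi) X Y Z g f)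
      = Comp FinLatt (rdp X) (rdp Y) (rdp Z) (rdp_map Z Y g) (rdp_map Y X f)"
    using rdp_map_compose by (auto simp: op_cat_def DSC_bi_def FinLatt_def)
qed

theorem corollary2p49:
  shows "(\<forall>(E::'a preDSC) (E'::'b preDSC) f.
            DSC E \<longrightarrow> DSC E' \<longrightarrow> DSC_morphism E E' f \<longrightarrow> DSC_bimorphism E E' f \<longrightarrow>
            finlatt_morphism (rdp E') (rdp E) (rdp_map E E' f))
       \<and> cat_functor (op_cat (DSC_bi :: ('c preDSC, 'c \<Rightarrow> 'c) cat)) FinLatt
            rdp (\<lambda>E' E f. rdp_map E E' f)"
  using rdp_map_finlatt_morphism rdp_functor by (auto simp: DSC_def)

end
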